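(* Let $T\in(0,\infty)$, $d\in\mathbb{N}$, and let $\mu:[0,T]\times\mathbb{R}^d\to\mathbb{R}^d$, $\sigma:[0,T]\times\mathbb{R}^d\to\mathbb{R}^{d\times d}$, $F:\mathbb{R}\times\mathbb{R}^d\to\mathbb{R}$, $g:\mathbb{R}^d\to\mathbb{R}$ be functions. Let $u\in C^{1,2}([0,T]\times\mathbb{R}^d,\mathbb{R})$ satisfy $$\frac{\partial u}{\partial r}+\mathcal{L}u+F(u,\sigma^\top\nabla_y u)=0\ \text{ on }[0,T)\times\mathbb{R}^d,\qquad u(T,y)=g(y)\ \text{ for } y\in\mathbb{R}^d,$$ where $\mathcal{L}v:=\langle\mu,\nabla_y v\rangle+\tfrac12\operatorname{Tr}(\sigma^\top\,\mathrm{Hess}_y(v)\,\sigma)$. Let $\hat u\in C^{1,2}([0,T]\times\mathbb{R}^d,\mathbb{R})$ be arbitrary, and define $$\epsilon(r,y):=\Big(\frac{\partial\hat u}{\partial r}+\mathcal{L}\hat u+F(\hat u,\sigma^\top\nabla_y\hat u)\Big)(r,y),\qquad \breve g(y):=g(y)-\hat u(T,y).$$ Then the defect $\breve u(r,y):=u(r,y)-\hat u(r,y)$ is a solution of the semi-linear parabolic equation $$\frac{\partial\breve u}{\partial r}+\mathcal{L}\breve u+\breve F(\breve u,\sigma^\top\nabla_y\breve u)=0\ \text{ on }[0,T)\times\mathbb{R}^d,\qquad \breve u(T,y)=\breve g(y)\ \text{ for } y\in\mathbb{R}^d,$$ where, at each point $(r,y)$, $$\breve F(\breve u,\sigma^\top\nabla_y\breve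 u):=F\big(\hat u+\breve u,\sigma^\top(\nabla_y\hat u+\nabla_y\breve u)\big)-F\big(\hat u,\sigma^\top\nabla_y\hat u\big)+\epsilon .$$
   Context: $C^{1,2}([0,T]\times\mathbb{R}^d,\mathbb{R})$ denotes functions that are once continuously differentiable in time and twice continuously differentiable in space. $\nabla_y$ and $\mathrm{Hess}_y$ are the gradient and Hessian in the space variable. The coefficients $\mu,\sigma$ are evaluated at $(r,y)$. *)

theory Defs
  imports "HOL-Analysis.Analysis"
begin

text \<open>
  Functions on \<open>[0,T] \<times> \<real>\<^sup>d\<close> are curried total functions of time and space; every
  notion below only looks at times in \<open>[0,T]\<close>, so values at other times are irrelevant.
\<close>

definition gradient :: "(real ^ 'd \<Rightarrow> real) \<Rightarrow> real ^ 'd \<Rightarrow> real ^ 'd" where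
  "gradient f y = (\<chi> i. frechet_derivative f (at y) (axis i 1))"

definition hessian :: "(real ^ 'd \<Rightarrow> real) \<Rightarrow> real ^ 'd \<Rightarrow> real ^ 'd ^ 'd" where
  "hessian f y = jacobian (gradient f) (at y)"

text \<open>One-sided at the end points \<open>0\<close> and \<open>T\<close>.\<close>

definition time_deriv :: "real \<Rightarrow> (real \<Rightarrow> real ^ 'd \<Rightarrow> real) \<Rightarrow> real \<Rightarrow> real ^ 'd \<Rightarrow> real" where
  "time_deriv T v r y = vector_derivative (\<lambda>s. v s y) (at r within {0..T})"

text \<open>
  The space \<open>C\<^sup>1\<^sup>,\<^sup>2([0,T] \<times> \<real>\<^sup>d, \<real>)\<close>: the derivatives exist and they are, together with
  the function itself, jointly continuous in time and space.
\<close>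

definition C12 :: "real \<Rightarrow> (real \<Rightarrow> real ^ 'd \<Rightarrow> real) \<Rightarrow> bool" where
  "C12 T v \<longleftrightarrow>
     (\<forall>r\<in>{0..T}. \<forall>y.
        (\<lambda>s. v s y) differentiable (at r within {0..T}) \<and>
        v r differentiable (at y) \<and>
        gradient (v r) differentiable (at y)) \<and>
     continuous_on ({0..T} \<times> UNIV) (\<lambda>(r, y). v r y) \<and>
     continuous_on ({0..T} \<times> UNIV) (\<lambda>(r, y). time_deriv T v r y) \<and>
     continuous_on ({0..T} \<times> UNIV) (\<lambda>(r, y). gradient (v r) y) \<and>
     continuous_on ({0..T} \<times> UNIV) (\<lambda>(r, y). hessian (v r) y)"

definition gen_L ::
  "(real \<Rightarrow> real ^ 'd \<Rightarrow> real ^ 'd) \<Rightarrow> (real \<Rightarrow> real ^ 'd \<Rightarrow> real ^ 'd ^ 'd) \<Rightarrow>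
   (real \<Rightarrow> real ^ 'd \<Rightarrow> real) \<Rightarrow> real \<Rightarrow> real ^ 'd \<Rightarrow> real" where
  "gen_L \<mu> \<sigma> v r y =
     \<mu> r y \<bullet> gradient (v r) y +
     1 / 2 * trace (transpose (\<sigma> r y) ** hessian (v r) y ** \<sigma> r y)"

text \<open>
  Classical solutions of \<open>\<partial>v/\<partial>r + L v + G(r, y, v, \<sigma>\<^sup>T \<nabla>v) = 0\<close> on \<open>[0,T) \<times> \<real>\<^sup>d\<close> with
  terminal condition \<open>v(T, y) = h(y)\<close>. The nonlinearity \<open>G\<close> may depend on \<open>(r, y)\<close>.
\<close>

definition semilinear_solution ::
  "real \<Rightarrow> (real \<Rightarrow> real ^ 'd \<Rightarrow> real ^ 'd) \<Rightarrow> (real \<Rightarrow> real ^ 'd \<Rightarrow> real ^ 'd ^ 'd) \<Rightarrow>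
   (real \<Rightarrow> real ^ 'd \<Rightarrow> real \<Rightarrow> real ^ 'd \<Rightarrow> real) \<Rightarrow> (real ^ 'd \<Rightarrow> real) \<Rightarrow>
   (real \<Rightarrow> real ^ 'd \<Rightarrow> real) \<Rightarrow> bool" where
  "semilinear_solution T \<mu> \<sigma> G h v \<longleftrightarrow>
     C12 T v \<and>
     (\<forall>r\<in>{0..<T}. \<forall>y.
        time_deriv T v r y + gen_L \<mu> \<sigma> v r y
          + G r y (v r y) (transpose (\<sigma> r y) *v gradient (v r) y) = 0) \<and>
     (\<forall>y. v T y = h y)"

end

theory Submission
  imports Defs
begin

text \<open>The time derivative, the gradient and the Hessian are linear, and \<open>gen_L\<close>
  is linear in the last two, so subtracting the expression for \<open>uh\<close> from the equation
  for \<open>u\<close> gives the linear part for the defect \<open>ub\<close>. The nonlinearity need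
  not be linear: \<open>Fb\<close> is built so that, evaluated at the defect, it equals
  \<open>F\<close> along \<open>u\<close> minus \<open>F\<close> along \<open>uh\<close> plus the
  residual \<open>\<epsilon>\<close>. Since \<open>\<epsilon>\<close> is exactly the expression for
  \<open>uh\<close>, all terms in \<open>uh\<close> cancel and the equation for \<open>u\<close>
  remains. The analytic content is \<open>C12_diff\<close>, which shows that the defect is again of
  class \<open>C12\<close> with the expected derivatives; \<open>gen_L_diff\<close> supplies the
  algebra.\<close>

lemma gradient_diff:
  assumes "f differentiable (at y)" and "h differentiable (at y)"
  shows "gradient (\<lambda>x. f x - h x) y = gradient f y - gradient h y"
proof -
  have "((\<lambda>x. f x - h x) has_derivative
      (\<lambda>v. frechet_derivative f (at y) v - frechet_derivative h (at y) v)) (at y)"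
    using assms by (intro has_derivative_diff) (simp_all add: frechet_derivative_works)
  from frechet_derivative_at[OF this, symmetric] show ?thesis
    by (simp add: gradient_def vec_eq_iff)
qed

lemma hessian_diff:
  assumes "\<And>x. f differentiable (at x)" and "\<And>x. h differentiable (at x)"
    and "gradient f differentiable (at y)" and "gradient h differentiable (at y)"
  shows "hessian (\<lambda>x. f x - h x) y = hessian f y - hessian h y"
proof -
  \<comment> \<open>The Hessian differentiates the gradient, so the gradient identity is needed as
    an equation of functions. Hence differentiability of \<open>f\<close> and \<open>h\<close> is
    assumed at every point.\<close>
  have *: "gradient (\<lambda>x. f x - h x) = (\<lambda>x. gradient f x - gradient h x)"
    using assms(1,2) by (simp add: gradient_diff fun_eq_iff)
  have "((\<lambda>x. gradient f x - gradient h x) has_derivative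
      (\<lambda>v. frechet_derivative (gradient f) (at y) v - frechet_derivative (gradient h) (at y) v)) (at y)"
    using assms(3,4) by (intro has_derivative_diff) (simp_all add: frechet_derivative_works)
  from frechet_derivative_at[OF this, symmetric] show ?thesis
    by (simp add: hessian_def jacobian_def * matrix_def vec_eq_iff)
qed

text \<open>The derivative is taken within \<open>{0..T}\<close>, so agreement of \<open>w\<close>
  with the difference on that interval suffices, end points included.\<close>

lemma time_derivative_diff:
  assumes "0 < T" "r \<in> {0..T}"
    and "(\<lambda>s. u s y) differentiable (at r within {0..T})"
    and "(\<lambda>s. v s y) differentiable (at r within {0..T})"
    and eq: "\<And>s. s \<in> {0..T} \<Longrightarrow> w s y = u s y - v s y"
  shows "(\<lambda>s. w s y) differentiable (at r within {0..T})"
    and "time_deriv T w r y = time_deriv T u r y - time_deriv T v r y"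
proof -
  have "((\<lambda>s. u s y - v s y) has_vector_derivative
      (time_deriv T u r y - time_deriv T v r y)) (at r within {0..T})"
    using assms(3,4) unfolding time_deriv_def
    by (intro has_vector_derivative_diff) (simp_all add: vector_derivative_works)
  then have *: "((\<lambda>s. w s y) has_vector_derivative
      (time_deriv T u r y - time_deriv T v r y)) (at r within {0..T})"
    by (rule has_vector_derivative_transform[OF assms(2) eq, rotated])
  then show "(\<lambda>s. w s y) differentiable (at r within {0..T})"
    by (rule differentiableI_vector)
  show "time_deriv T w r y = time_deriv T u r y - time_deriv T v r y"
    unfolding time_deriv_def[of T w]
    \<comment> \<open>With \<open>0 < T\<close> the interval is nondegenerate, so even a one-sided
      derivative at an end point is unique.\<close>
    by (rule vector_derivative_within_closed_interval[OF assms(1,2) *])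
qed

lemma matrix_diff_ldistrib:
  fixes A :: "'a::ring_1 ^ 'n ^ 'm"
  shows "A ** (B - C) = A ** B - A ** C"
  by (simp add: matrix_matrix_mult_def vec_eq_iff right_diff_distrib sum_subtractf)

lemma matrix_diff_rdistrib:
  fixes A :: "'a::ring_1 ^ 'n ^ 'm"
  shows "(A - B) ** C = A ** C - B ** C"
  by (simp add: matrix_matrix_mult_def vec_eq_iff left_diff_distrib sum_subtractf)

text \<open>Only values at one point enter: the inner product, the matrix products and the trace are
  linear in the gradient and the Hessian.\<close>

lemma gen_L_diff:
  assumes "gradient (w r) y = gradient (u r) y - gradient (v r) y"
    and "hessian (w r) y = hessian (u r) y - hessian (v r) y"
  shows "gen_L \<mu> \<sigma> w r y = gen_L \<mu> \<sigma> u r y - gen_L \<mu> \<sigma> v r y"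
  by (simp add: gen_L_def assms matrix_diff_ldistrib matrix_diff_rdistrib trace_sub
      inner_diff_right diff_divide_distrib)

text \<open>The value type is general so that it covers the function, its time derivative, its
  gradient and its Hessian alike.\<close>

lemma continuous_on_diff_case_prod:
  fixes a b c :: "'s::topological_space \<Rightarrow> 't::topological_space \<Rightarrow> 'v::real_normed_vector"
  assumes "continuous_on (A \<times> UNIV) (\<lambda>(r, y). a r y)"
    and "continuous_on (A \<times> UNIV) (\<lambda>(r, y). b r y)"
    and "\<And>r y. r \<in> A \<Longrightarrow> c r y = a r y - b r y"
  shows "continuous_on (A \<times> UNIV) (\<lambda>(r, y). c r y)"
  using continuous_on_diff[OF assms(1,2)]
  by (rule continuous_on_eq) (auto simp: assms(3))

lemma C12_diff:
  assumes T: "0 < T" and u: "C12 T u" and v: "C12 T v"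
    and eq: "\<And>r y. r \<in> {0..T} \<Longrightarrow> w r y = u r y - v r y"
  shows "C12 T w"
    and "\<And>r y. r \<in> {0..T} \<Longrightarrow> time_deriv T w r y = time_deriv T u r y - time_deriv T v r y"
    and "\<And>r y. r \<in> {0..T} \<Longrightarrow> gradient (w r) y = gradient (u r) y - gradient (v r) y"
    and "\<And>r y. r \<in> {0..T} \<Longrightarrow> hessian (w r) y = hessian (u r) y - hessian (v r) y"
proof -
  \<comment> \<open>At a fixed time in \<open>{0..T}\<close> the equality holds for all
    \<open>y\<close>, so the whole spatial slice can be replaced under \<open>gradient\<close> and
    \<open>hessian\<close>.\<close>
  have w: "w r = (\<lambda>y. u r y - v r y)" if "r \<in> {0..T}" for r
    using eq[OF that] by (simp add: fun_eq_iff)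
  have dt: "(\<lambda>s. u s y) differentiable (at r within {0..T})"
      "(\<lambda>s. v s y) differentiable (at r within {0..T})"
    and dx: "u r differentiable (at y)" "v r differentiable (at y)"
    and dxx: "gradient (u r) differentiable (at y)" "gradient (v r) differentiable (at y)"
    if "r \<in> {0..T}" for r y
    using u v that by (auto simp: C12_def)
  have cu: "continuous_on ({0..T} \<times> UNIV) (\<lambda>(r, y). u r y)"
      "continuous_on ({0..T} \<times> UNIV) (\<lambda>(r, y). time_deriv T u r y)"
      "continuous_on ({0..T} \<times> UNIV) (\<lambda>(r, y). gradient (u r) y)"
      "continuous_on ({0..T} \<times> UNIV) (\<lambda>(r, y). hessian (u r) y)"
    using u by (simp_all only: C12_def)
  have cv: "continuous_on ({0..T} \<times> UNIV) (\<lambda>(r, y). v r y)"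
      "continuous_on ({0..T} \<times> UNIV) (\<lambda>(r, y). time_deriv T v r y)"
      "continuous_on ({0..T} \<times> UNIV) (\<lambda>(r, y). gradient (v r) y)"
      "continuous_on ({0..T} \<times> UNIV) (\<lambda>(r, y). hessian (v r) y)"
    using v by (simp_all only: C12_def)
  show time: "time_deriv T w r y = time_deriv T u r y - time_deriv T v r y" if "r \<in> {0..T}" for r y
    by (rule time_derivative_diff(2)[OF T that dt[OF that] eq])
  show grad: "gradient (w r) y = gradient (u r) y - gradient (v r) y" if "r \<in> {0..T}" for r y
    using gradient_diff[OF dx[OF that]] w[OF that] by simp
  show hess: "hessian (w r) y = hessian (u r) y - hessian (v r) y" if "r \<in> {0..T}" for r y
    using hessian_diff[OF dx[OF that] dxx[OF that]] w[OF that] by simp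
  have "(\<lambda>s. w s y) differentiable (at r within {0..T})" if "r \<in> {0..T}" for r y
    by (rule time_derivative_diff(1)[OF T that dt[OF that] eq])
  moreover have "w r differentiable (at y)" if "r \<in> {0..T}" for r y
    using dx[OF that] w[OF that] by simp
  moreover have "gradient (w r) differentiable (at y)" if "r \<in> {0..T}" for r y
  proof -
    have "gradient (w r) = (\<lambda>x. gradient (u r) x - gradient (v r) x)"
      using grad[OF that] by (simp add: fun_eq_iff)
    then show ?thesis using dxx[OF that] by simp
  qed
  moreover have "continuous_on ({0..T} \<times> UNIV) (\<lambda>(r, y). w r y)"
    by (rule continuous_on_diff_case_prod[OF cu(1) cv(1) eq])
  moreover have "continuous_on ({0..T} \<times> UNIV) (\<lambda>(r, y). time_deriv T w r y)"
    by (rule continuous_on_diff_case_prod[OF cu(2) cv(2) time])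
  moreover have "continuous_on ({0..T} \<times> UNIV) (\<lambda>(r, y). gradient (w r) y)"
    by (rule continuous_on_diff_case_prod[OF cu(3) cv(3) grad])
  moreover have "continuous_on ({0..T} \<times> UNIV) (\<lambda>(r, y). hessian (w r) y)"
    by (rule continuous_on_diff_case_prod[OF cu(4) cv(4) hess])
  ultimately show "C12 T w"
    by (simp add: C12_def)
qed

text \<open>\<open>Fb\<close> is prescribed only at arguments of the form
  \<open>transpose (\<sigma> r y) *v p\<close>. This is consistent even for singular
  \<open>\<sigma> r y\<close>: by linearity the right-hand side depends on \<open>p\<close> only
  through that product.\<close>

theorem fact3p1:
  fixes T :: real
    and \<mu> :: "real \<Rightarrow> real ^ 'd \<Rightarrow> real ^ 'd"
    and \<sigma> :: "real \<Rightarrow> real ^ 'd \<Rightarrow> real ^ 'd ^ 'd"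
    and F :: "real \<Rightarrow> real ^ 'd \<Rightarrow> real"
    and g gb :: "real ^ 'd \<Rightarrow> real"
    and u uh ub \<epsilon> :: "real \<Rightarrow> real ^ 'd \<Rightarrow> real"
    and Fb :: "real \<Rightarrow> real ^ 'd \<Rightarrow> real \<Rightarrow> real ^ 'd \<Rightarrow> real"
  assumes T: "0 < T"
    and u: "semilinear_solution T \<mu> \<sigma> (\<lambda>r y. F) g u"
    and uh: "C12 T uh"
    and eps: "\<forall>r\<in>{0..T}. \<forall>y. \<epsilon> r y =
           time_deriv T uh r y + gen_L \<mu> \<sigma> uh r y
             + F (uh r y) (transpose (\<sigma> r y) *v gradient (uh r) y)"
    and gb: "\<forall>y. gb y = g y - uh T y"
    and ub: "\<forall>r\<in>{0..T}. \<forall>y. ub r y = u r y - uh r y"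
    and Fb: "\<forall>r\<in>{0..T}. \<forall>y w p. Fb r y w (transpose (\<sigma> r y) *v p) =
           F (uh r y + w) (transpose (\<sigma> r y) *v (gradient (uh r) y + p))
             - F (uh r y) (transpose (\<sigma> r y) *v gradient (uh r) y) + \<epsilon> r y"
  shows "semilinear_solution T \<mu> \<sigma> Fb gb ub"
proof -
  have C: "C12 T u"
    and pde: "\<And>r y. r \<in> {0..<T} \<Longrightarrow> time_deriv T u r y + gen_L \<mu> \<sigma> u r y
          + F (u r y) (transpose (\<sigma> r y) *v gradient (u r) y) = 0"
    and terminal: "\<And>y. u T y = g y"
    using u unfolding semilinear_solution_def by blast+
  have ub': "\<And>r y. r \<in> {0..T} \<Longrightarrow> ub r y = u r y - uh r y"
    using ub by blast
  have diff: "C12 T ub"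
    "r \<in> {0..T} \<Longrightarrow> time_deriv T ub r y = time_deriv T u r y - time_deriv T uh r y"
    "r \<in> {0..T} \<Longrightarrow> gradient (ub r) y = gradient (u r) y - gradient (uh r) y"
    "r \<in> {0..T} \<Longrightarrow> hessian (ub r) y = hessian (u r) y - hessian (uh r) y" for r y
    by (rule C12_diff[OF T C uh], erule ub', assumption?)+
  have "time_deriv T ub r y + gen_L \<mu> \<sigma> ub r y
      + Fb r y (ub r y) (transpose (\<sigma> r y) *v gradient (ub r) y) = 0" if "r \<in> {0..<T}" for r y
  proof -
    from that have r: "r \<in> {0..T}" by simp
    have Fb': "Fb r y (ub r y) (transpose (\<sigma> r y) *v gradient (ub r) y) =
        F (u r y) (transpose (\<sigma> r y) *v gradient (u r) y)
          - F (uh r y) (transpose (\<sigma> r y) *v gradient (uh r) y) + \<epsilon> r y"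
      \<comment> \<open>The equation for \<open>Fb\<close> is used with \<open>w\<close> the defect
        and \<open>p\<close> its gradient; then \<open>uh + (u - uh)\<close> and the corresponding
        sum of gradients collapse to \<open>u\<close> and its gradient.\<close>
      by (simp only: Fb[rule_format, OF r]) (simp add: diff(3)[OF r] ub'[OF r])
    show ?thesis
      \<comment> \<open>Once \<open>\<epsilon>\<close> is expanded, every \<open>uh\<close> term
        occurs with both signs, leaving \<open>pde\<close> at \<open>(r, y)\<close>.\<close>
      unfolding Fb' diff(2)[OF r] gen_L_diff[of ub r y u uh, OF diff(3)[OF r] diff(4)[OF r]] eps[rule_format, OF r]
      using pde[OF that, of y] by linarith
  qed
  moreover have "ub T y = gb y" for y
    \<comment> \<open>Here \<open>0 < T\<close> places the terminal time in \<open>{0..T}\<close>,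
      where \<open>ub\<close> is the defect.\<close>
    using ub gb terminal T by simp
  ultimately show ?thesis
    using diff(1) unfolding semilinear_solution_def by blast
qed

end
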